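(* Let $q$ be an odd prime power and $0<u\le 1$. Define a random sequence of non-negative integers $\lambda_1',\lambda_2',\lambda_3',\ldots$ as follows: $\lambda_1'$ is distributed as $P_{O,u}$; then, in succession for $i=1,2,3,\ldots$, given that $\lambda_i'=a$ (and given the earlier values), set $\lambda_{i+1}'=b$ with probability $K_2(a,b)$ if $i$ is odd, and with probability $K_1(a,b)$ if $i$ is even. Then the resulting partition $\lambda$ (the one whose column lengths are $\lambda_1'\ge\lambda_2'\ge\cdots$) is distributed according to $M_{O,u}$; that is, each partition $\lambda$ arises with probability $M_{O,u}(\lambda)$.
   Context: For a partition $\lambda$, $m_i=m_i(\lambda)$ is the number of parts equal to $i$, $\lambda_i'=m_i+m_{i+1}+\cdots$ is the length of the $i$-th column of its diagram, and $|\lambda|$ is the sum of its parts. The measure $M_{O,u}$ on the set of all partitions of all non-negative integers: $M_{O,u}(\lambda)=0$ unless every even part of $\lambda$ has even multiplicity, in which case $$M_{O,u}(\lambda)=\frac{1}{1+u}\prod_{r=1}^{\infty}\Bigl(1-\frac{u^2}{q^{2r-1}}\Bigr)\,\frac{u^{|\lambda|}}{q^{\frac12\left[\sum_i(\lambda_i')^2-\sum_i m_i^2\right]}\prod_{i\ge1}c_i},$$ where - if $i$ is even: $c_i=q^{m_i^2/4-m_i/2}\prod_{l=1}^{m_i/2}(q^{2l}-1)$; - if $i$ is odd and $m_i$ is even: $c_i=q^{m_i^2/4-m_i}\prod_{l=1}^{m_i/2}(q^{2l}-1)$; - if $i$ is odd and $m_i$ is odd: $c_i=q^{(m_i-1)^2/4}\prod_{l=1}^{(m_i-1)/2}(q^{2l}-1)$.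 $P_{O,u}(a)$ denotes the $M_{O,u}$-measure of the set of partitions with exactly $a$ parts (i.e. with $\lambda_1'=a$). It equals $P_{O,u}(a)=\frac{1}{1+u}\prod_{r\ge1}(1-u^2/q^{2r-1})\,P'_{O,u}(a)$, where for $k\ge0$ $$P'_{O,u}(2k)=\frac{u^{2k}}{q^{2k^2-k}\prod_{i=1}^{k}(1-u^2/q^{2i-1})(1-1/q^{2i})},\qquad P'_{O,u}(2k+1)=\frac{u^{2k+1}}{q^{2k^2+k}\prod_{i=1}^{k+1}(1-u^2/q^{2i-1})\prod_{i=1}^{k}(1-1/q^{2i})}.$$ Also set, for $k\ge 0$, $$P'_{Sp,u}(2k)=\frac{u^{2k}}{q^{2k^2+k}\prod_{i=1}^{k}(1-u^2/q^{2i-1})(1-1/q^{2i})},\qquad P'_{Sp,u}(2k+1)=\frac{u^{2k+2}}{q^{2k^2+3k+1}\prod_{i=1}^{k+1}(1-u^2/q^{2i-1})\prod_{i=1}^{k}(1-1/q^{2i})}.$$ The Markov chains $K_1,K_2$ on $\{0,1,2,\ldots\}$ have $K_1(a,b)=K_2(a,b)=0$ for $b>a$, and for $b\le a$: $$K_1(a,b)=\begin{cases}\dfrac{u^a P'_{O,u}(b)}{P'_{Sp,u}(a)\,q^{\frac{a^2-b^2+2(a+1)b}{4}}\,(q^{a-b}-1)\cdots(q^4-1)(q^2-1)} & a-b\text{ even},\\[2ex] 0 & a-b\text{ odd},\end{cases}$$ $$K_2(a,b)=\begin{cases}\dfrac{u^a P'_{Sp,u}(b)\,q^{(a-b)^2/4}}{P'_{O,u}(a)\,q^{\frac{a^2+b}{2}-a}\,(q^{a-b}-1)\cdots(q^4-1)(q^2-1)}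 & a-b\text{ even},\\[2ex] \dfrac{u^a P'_{Sp,u}(b)\,q^{((a-b)^2-1)/4}}{P'_{O,u}(a)\,q^{\frac{a^2-a}{2}}\,(q^{a-b-1}-1)\cdots(q^4-1)(q^2-1)} & a-b\text{ odd}.\end{cases}$$ The products of factors $q^{2l}-1$ are empty (equal to $1$) when $a-b=0$, respectively $a-b=1$. $P_{O,u}$ sums to one, as do the rows of $K_1$ and $K_2$. *)

theory Defs
  imports
    "HOL-Probability.Probability"
    "HOL-Number_Theory.Prime_Powers"
    "HOL-Library.Multiset"
begin

(* A partition is the multiset of its parts, which are positive: m_i is "count lam i",
   |lam| is "sum_mset lam" and the number of parts is "size lam". *)
definition partitions :: "nat multiset set" where
  "partitions = {lam. 0 \<notin># lam}"

(* The length m_i + m_(i+1) + ... of the i-th column, for i >= 1. *)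
definition col :: "nat multiset \<Rightarrow> nat \<Rightarrow> nat" where
  "col lam i = size {# p \<in># lam. i \<le> p #}"

(* Real exponents that need not visibly be natural numbers are written with powr throughout;
   the base is always positive. *)

(* The case of even i and odd m_i never contributes: M_O is 0 there. *)
definition c_O :: "real \<Rightarrow> nat multiset \<Rightarrow> nat \<Rightarrow> real" where
  "c_O q lam i =
     (let m = count lam i in
      if even i then
        q powr ((real m)\<^sup>2 / 4 - real m / 2) * (\<Prod>l = 1..m div 2. q ^ (2 * l) - 1)
      else if even m then
        q powr ((real m)\<^sup>2 / 4 - real m) * (\<Prod>l = 1..m div 2. q ^ (2 * l) - 1)
      else
        q powr ((real m - 1)\<^sup>2 / 4) * (\<Prod>l = 1..(m - 1) div 2. q ^ (2 * l) - 1))"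

(* The sums and the product over all i >= 1 are cut off at i = |lam|: for larger i one has
   m_i = 0, col lam i = 0 and c_i = 1.  The infinite product over r >= 1 is indexed from 0. *)
definition M_O :: "real \<Rightarrow> real \<Rightarrow> nat multiset \<Rightarrow> real" where
  "M_O u q lam =
     (if \<forall>i. i \<in># lam \<and> even i \<longrightarrow> even (count lam i) then
        1 / (1 + u) * (\<Prod>r. 1 - u\<^sup>2 / q ^ (2 * r + 1)) *
        (u ^ sum_mset lam /
          (q powr (((\<Sum>i = 1..sum_mset lam. (real (col lam i))\<^sup>2)
                    - (\<Sum>i = 1..sum_mset lam. (real (count lam i))\<^sup>2)) / 2)
           * (\<Prod>i = 1..sum_mset lam. c_O q lam i)))
      else 0)"

definition M_O_measure :: "real \<Rightarrow> real \<Rightarrow> nat multiset measure" where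
  "M_O_measure u q = point_measure partitions (\<lambda>lam. ennreal (M_O u q lam))"

definition P_O :: "real \<Rightarrow> real \<Rightarrow> nat \<Rightarrow> ennreal" where
  "P_O u q a = emeasure (M_O_measure u q) {lam \<in> partitions. size lam = a}"

(* P'_O and P'_Sp.  In both branches k = n div 2, so n = 2k or n = 2k + 1. *)
definition P'_O :: "real \<Rightarrow> real \<Rightarrow> nat \<Rightarrow> real" where
  "P'_O u q n =
     (let k = n div 2 in
      if even n then
        u ^ (2 * k) /
        (q ^ (2 * k\<^sup>2 - k) * (\<Prod>i = 1..k. (1 - u\<^sup>2 / q ^ (2 * i - 1)) * (1 - 1 / q ^ (2 * i))))
      else
        u ^ (2 * k + 1) /
        (q ^ (2 * k\<^sup>2 + k) * (\<Prod>i = 1..k + 1. 1 - u\<^sup>2 / q ^ (2 * i - 1))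
          * (\<Prod>i = 1..k. 1 - 1 / q ^ (2 * i))))"

definition P'_Sp :: "real \<Rightarrow> real \<Rightarrow> nat \<Rightarrow> real" where
  "P'_Sp u q n =
     (let k = n div 2 in
      if even n then
        u ^ (2 * k) /
        (q ^ (2 * k\<^sup>2 + k) * (\<Prod>i = 1..k. (1 - u\<^sup>2 / q ^ (2 * i - 1)) * (1 - 1 / q ^ (2 * i))))
      else
        u ^ (2 * k + 2) /
        (q ^ (2 * k\<^sup>2 + 3 * k + 1) * (\<Prod>i = 1..k + 1. 1 - u\<^sup>2 / q ^ (2 * i - 1))
          * (\<Prod>i = 1..k. 1 - 1 / q ^ (2 * i))))"

definition K1 :: "real \<Rightarrow> real \<Rightarrow> nat \<Rightarrow> nat \<Rightarrow> real" where
  "K1 u q a b =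
     (if b \<le> a \<and> even (a - b) then
        u ^ a * P'_O u q b /
        (P'_Sp u q a
          * q powr (((real a)\<^sup>2 - (real b)\<^sup>2 + 2 * (real a + 1) * real b) / 4)
          * (\<Prod>l = 1..(a - b) div 2. q ^ (2 * l) - 1))
      else 0)"

definition K2 :: "real \<Rightarrow> real \<Rightarrow> nat \<Rightarrow> nat \<Rightarrow> real" where
  "K2 u q a b =
     (if b > a then 0
      else if even (a - b) then
        u ^ a * P'_Sp u q b * q powr ((real a - real b)\<^sup>2 / 4) /
        (P'_O u q a * q powr (((real a)\<^sup>2 + real b) / 2 - real a)
          * (\<Prod>l = 1..(a - b) div 2. q ^ (2 * l) - 1))
      else
        u ^ a * P'_Sp u q b * q powr (((real a - real b)\<^sup>2 - 1) / 4) /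
        (P'_O u q a * q powr (((real a)\<^sup>2 - real a) / 2)
          * (\<Prod>l = 1..(a - b - 1) div 2. q ^ (2 * l) - 1)))"

end

theory Submission
  imports Defs
begin

text \<open>
  Up to a gauge factor that telescopes along a path, one step of the chain from \<open>a\<close> to \<open>b\<close> contributes
  exactly the factor of \<open>M_O\<close> belonging to a column of length \<open>a\<close> followed by one of length \<open>b\<close>.  Hence a
  path ending in \<open>0\<close> that encodes \<open>lam\<close> has probability \<open>r a * M_O lam\<close>, where \<open>a = size lam\<close> and
  \<open>r a = P_O a / (C * P'_O a)\<close> for the normalising constant \<open>C\<close> of \<open>M_O\<close>.  As \<open>K2 a a \<le> 1 / q\<close> and
  \<open>K1 a a \<le> 1\<close>, the sequence is almost surely absorbed in \<open>0\<close>, so summing over all \<open>lam\<close> with \<open>a\<close> parts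
  gives \<open>P_O a = r a * P_O a\<close>, that is, \<open>r a = 1\<close> whenever \<open>P_O a \<noteq> 0\<close>.  In this way no \<open>q\<close>-series
  identity for \<open>P_O\<close> is needed, and \<open>C > 0\<close> follows from the total mass being \<open>1\<close>.
\<close>

section \<open>Partitions and their column lengths\<close>

lemma countable_multisets: "countable (S :: 'a::countable multiset set)"
proof (rule countable_subset)
  show "S \<subseteq> range mset" by (metis UNIV_I ex_mset image_eqI subsetI)
qed simp

lemma col_Suc: "col lam i = count lam i + col lam (Suc i)"
  by (induction lam) (auto simp: col_def)

lemma col_eq_0: "sum_mset lam < i \<Longrightarrow> col lam i = 0"
  by (induction lam) (auto simp: col_def)

text \<open>Double counting of the cells of the diagram: a part \<open>x\<close> meets exactly the
  columns \<open>1..x\<close>, and no part exceeds the cutoff \<open>n\<close>.\<close>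

lemma sum_col: "sum_mset lam \<le> n \<Longrightarrow> (\<Sum>i = 1..n. col lam i) = sum_mset lam"
proof (induction lam)
  case empty
  then show ?case by (simp add: col_def)
next
  case (add x lam)
  have "(\<Sum>i = 1..n. col (add_mset x lam) i)
      = (\<Sum>i = 1..n. (if i \<le> x then 1 else 0) + col lam i)"
    by (intro sum.cong) (auto simp: col_def)
  also have "\<dots> = card {i \<in> {1..n}. i \<le> x} + sum_mset lam"
    using add by (simp add: sum.distrib sum.If_cases Int_def)
  also have "{i \<in> {1..n}. i \<le> x} = {1..x}"
    using add.prems by auto
  finally show ?case by simp
qed

lemma col_1: "lam \<in> partitions \<Longrightarrow> col lam 1 = size lam"
  by (induction lam) (auto simp: col_def partitions_def)

text \<open>Multiplicities are differences of consecutive column lengths; the multiplicity of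
  \<open>0\<close>, invisible to these columns, vanishes in \<open>partitions\<close>.\<close>

lemma col_inject:
  assumes "lam \<in> partitions" "mu \<in> partitions" "\<And>i. i \<ge> 1 \<Longrightarrow> col lam i = col mu i"
  shows "lam = mu"
proof (rule multiset_eqI)
  fix i
  show "count lam i = count mu i"
  proof (cases "i = 0")
    case True
    then show ?thesis
      using assms(1,2) unfolding partitions_def by (metis count_eq_zero_iff mem_Collect_eq)
  next
    case False
    then show ?thesis
      using assms(3)[of i] assms(3)[of "Suc i"] col_Suc[of lam i] col_Suc[of mu i] by simp
  qed
qed

text \<open>Conjugation of diagrams: the drop from \<open>h i\<close> to \<open>h (Suc i)\<close> is
  the number of parts equal to \<open>i\<close>.\<close>

lemma ex_partition_col:
  assumes mono: "\<And>i. i \<ge> 1 \<Longrightarrow> h (Suc i) \<le> h i" and zero: "\<And>i. i \<ge> n \<Longrightarrow> h i = 0"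
  shows "\<exists>lam\<in>partitions. \<forall>i\<ge>1. h i = col lam i"
proof -
  define lam where "lam = (\<Sum>i = 1..n. replicate_mset (h i - h (Suc i)) i)"
  have count: "count lam i = (if i \<in> {1..n} then h i - h (Suc i) else 0)" for i
    unfolding lam_def by (simp add: count_sum sum.delta)
  have "lam \<in> partitions"
    using count[of 0] by (simp add: partitions_def count_eq_zero_iff)
  moreover have "h i = col lam i" if "i \<ge> 1" for i
  proof -
    \<comment> \<open>At this \<open>N\<close>, beyond both \<open>n\<close> and the sum of
      \<open>lam\<close>, both sides are \<open>0\<close>; equality then descends from
      \<open>N\<close> to \<open>i\<close>.\<close>
    define N where "N = Suc (i + n + sum_mset lam)"
    have "i \<le> N" by (simp add: N_def)
    then show ?thesis using \<open>i \<ge> 1\<close>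
    proof (induction rule: inc_induct)
      case base
      show ?case using zero[of N] col_eq_0[of lam N] by (simp add: N_def)
    next
      case (step m)
      have "count lam m = h m - h (Suc m)"
        using count[of m] zero[of m] step.prems by auto
      then show ?case
        using step.IH mono[of m] step.prems col_Suc[of lam m] by simp
    qed
  qed
  ultimately show ?thesis by blast
qed

section \<open>Kernels, gauge and column weights\<close>

definition step_kernel :: "real \<Rightarrow> real \<Rightarrow> nat \<Rightarrow> nat \<Rightarrow> nat \<Rightarrow> real" where
  "step_kernel u q i = (if odd i then K2 u q else K1 u q)"

text \<open>The powers of \<open>q\<close> in \<open>K2 a b\<close> and \<open>K1 b c\<close> are off from those in \<open>M_O\<close> by \<open>b / 2\<close> and \<open>- b / 2\<close>;
  the factor \<open>q powr (a / 2)\<close> absorbs this.\<close>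

definition gauge_fn :: "real \<Rightarrow> real \<Rightarrow> nat \<Rightarrow> nat \<Rightarrow> real" where
  "gauge_fn u q i a = (if odd i then P'_O u q a else P'_Sp u q a * q powr (real a / 2))"

text \<open>The factor \<open>c_O\<close> as a function of the multiplicity alone, which for a chain
  step from \<open>a\<close> to \<open>b\<close> is \<open>a - b\<close>.\<close>

definition mult_factor :: "real \<Rightarrow> nat \<Rightarrow> nat \<Rightarrow> real" where
  "mult_factor q i m =
      (if even i then
        q powr ((real m)\<^sup>2 / 4 - real m / 2) * (\<Prod>l = 1..m div 2. q ^ (2 * l) - 1)
      else if even m then
        q powr ((real m)\<^sup>2 / 4 - real m) * (\<Prod>l = 1..m div 2. q ^ (2 * l) - 1)
      else
        q powr ((real m - 1)\<^sup>2 / 4) * (\<Prod>l = 1..(m - 1) div 2. q ^ (2 * l) - 1))"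

text \<open>The zero branch carries the condition that even parts have even multiplicity, so that a
  plain product of weights also covers the partitions outside the support of
  \<open>M_O\<close>.\<close>

definition col_weight :: "real \<Rightarrow> real \<Rightarrow> nat \<Rightarrow> nat \<Rightarrow> nat \<Rightarrow> real" where
  "col_weight u q i a b =
    (if even i \<and> odd (a - b) then 0
     else u ^ a / (q powr (((real a)\<^sup>2 - (real (a - b))\<^sup>2) / 2) * mult_factor q i (a - b)))"

lemma qprod_pos: "q > 1 \<Longrightarrow> (\<Prod>l = 1..(n::nat). q ^ (2 * l) - 1 :: real) > 0"
  by (intro prod_pos) auto

lemma mult_factor_pos: "q > 1 \<Longrightarrow> mult_factor q i m > 0"
  using qprod_pos[of q "m div 2"] qprod_pos[of q "(m - 1) div 2"]
  by (simp add: mult_factor_def)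

lemma col_weight_nonneg: "q > 1 \<Longrightarrow> u \<ge> 0 \<Longrightarrow> col_weight u q i a b \<ge> 0"
  using mult_factor_pos[of q i "a - b"] by (simp add: col_weight_def)

lemma col_weight_0 [simp]: "q > 1 \<Longrightarrow> col_weight u q i 0 0 = 1"
  by (simp add: col_weight_def mult_factor_def)

lemma gauge_fn_0 [simp]: "q > 1 \<Longrightarrow> gauge_fn u q i 0 = 1"
  by (simp add: gauge_fn_def P'_O_def P'_Sp_def)

section \<open>Positivity, diagonal bounds and the gauge identity for the kernels\<close>

context
  fixes u q :: real
  assumes q: "q > 1" and u: "0 < u" "u \<le> 1"
begin

lemma prod_odd_pos: "(\<Prod>i = 1..(n::nat). 1 - u\<^sup>2 / q ^ (2 * i - 1)) > 0"
proof (intro prod_pos ballI)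
  fix i assume i: "i \<in> {1..n}"
  have "u\<^sup>2 \<le> 1" using u by (simp add: power_le_one)
  also have "1 < q ^ (2 * i - 1)" using q i by (intro one_less_power) auto
  finally have "u\<^sup>2 / q ^ (2 * i - 1) < 1" using q by (simp add: divide_less_eq)
  then show "0 < 1 - u\<^sup>2 / q ^ (2 * i - 1)" by simp
qed

lemma prod_even_pos: "(\<Prod>i = 1..(n::nat). 1 - 1 / q ^ (2 * i)) > 0"
  using q by (intro prod_pos) auto

lemma P'_O_pos: "P'_O u q n > 0"
  unfolding P'_O_def Let_def prod.distrib using q u
  by (cases "even n"; simp only: if_True if_False;
      intro divide_pos_pos mult_pos_pos zero_less_power prod_odd_pos prod_even_pos; simp)

lemma P'_Sp_pos: "P'_Sp u q n > 0"
  unfolding P'_Sp_def Let_def prod.distrib using q u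
  by (cases "even n"; simp only: if_True if_False;
      intro divide_pos_pos mult_pos_pos zero_less_power prod_odd_pos prod_even_pos; simp)

text \<open>Both families share their products over \<open>i\<close> and differ only in powers of
  \<open>q\<close> and \<open>u\<close>, so on the diagonal of the kernels only such powers
  remain.\<close>

lemma P'_Sp_eq: "P'_Sp u q n = P'_O u q n * (if even n then 1 else u) / q ^ n"
proof (cases "even n")
  case True
  define k where "k = n div 2"
  have n: "n = 2 * k" using True by (simp add: k_def)
  \<comment> \<open>The truncated subtraction is exact, as
    \<open>k \<le> 2 * k\<^sup>2\<close>.\<close>
  have "2 * k\<^sup>2 + k = (2 * k\<^sup>2 - k) + 2 * k"
    by (cases k) (auto simp: power2_eq_square)
  then have "q ^ (2 * k\<^sup>2 + k) = q ^ (2 * k\<^sup>2 - k) * q ^ (2 * k)"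
    by (metis power_add)
  then show ?thesis by (simp add: P'_Sp_def P'_O_def n Let_def)
next
  case False
  define k where "k = n div 2"
  have n: "n = 2 * k + 1" using False by (simp add: k_def)
  have "q ^ (2 * k\<^sup>2 + 3 * k + 1) = q ^ (2 * k\<^sup>2 + k) * q ^ (2 * k + 1)"
    unfolding power_add[symmetric] by (rule arg_cong[where f = "(^) q"]) simp
  then show ?thesis
    using q by (simp add: P'_Sp_def P'_O_def n Let_def mult_ac power_add del: prod.cl_ivl_Suc)
qed

text \<open>The ratio of \<open>P'_Sp\<close> to \<open>P'_O\<close> supplies at most
  \<open>1 / q ^ a\<close>, and the remaining exponent \<open>(a\<^sup>2 - a) / 2\<close> is
  nonnegative. A bound below \<open>1\<close> is what later excludes a positive constant
  tail.\<close>

lemma K2_diag_le: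
  assumes "a \<ge> 1"
  shows "K2 u q a a \<le> 1 / q"
proof -
  have "K2 u q a a = u ^ a * (if even a then 1 else u) / (q ^ a * q powr (((real a)\<^sup>2 + real a) / 2 - real a))"
    using P'_O_pos[of a] q by (simp add: K2_def P'_Sp_eq)
  also have "\<dots> \<le> 1 / (q * 1)"
  proof (intro frac_le mult_mono mult_le_one)
    have "real a \<le> (real a)\<^sup>2" using assms by (simp add: power2_eq_square)
    then show "1 \<le> q powr (((real a)\<^sup>2 + real a) / 2 - real a)"
      using q by (intro ge_one_powr_ge_zero) auto
    show "q \<le> q ^ a" using q assms by (intro self_le_power) auto
  qed (use q u in \<open>auto simp: power_le_one\<close>)
  finally show ?thesis by simp
qed

text \<open>The inverse ratio now supplies \<open>q ^ a\<close>, which the exponent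
  \<open>a * (a + 1) / 2\<close> outweighs; for odd \<open>a\<close> the division by
  \<open>u\<close> uses up one factor of \<open>u ^ a\<close>.\<close>

lemma K1_diag_le: "K1 u q a a \<le> 1"
proof -
  let ?e = "if even a then 1 else u"
  have "K1 u q a a = (u ^ a / ?e) * (q powr real a / q powr ((2 * (real a + 1) * real a) / 4))"
    using P'_O_pos[of a] q u by (simp add: K1_def P'_Sp_eq powr_realpow)
  also have "\<dots> \<le> 1"
  proof (rule mult_le_one)
    have "u ^ a \<le> u ^ 1" if "odd a"
      using u odd_pos[OF that] by (intro power_decreasing) auto
    then show "u ^ a / ?e \<le> 1" using u by (auto simp: power_le_one)
    have "real a \<le> (real a)\<^sup>2" by (cases a) (auto simp: power2_eq_square)
    then have "q powr real a \<le> q powr ((2 * (real a + 1) * real a) / 4)"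
      using q by (intro powr_mono) (auto simp: algebra_simps power2_eq_square)
    then show "q powr real a / q powr ((2 * (real a + 1) * real a) / 4) \<le> 1"
      using q by simp
  qed simp
  finally show ?thesis .
qed

lemma kernel_nonneg: "step_kernel u q i a b \<ge> 0"
  using q u P'_O_pos[of a] P'_Sp_pos[of a] P'_O_pos[of b] P'_Sp_pos[of b]
    qprod_pos[OF q, of "(a - b) div 2"] qprod_pos[OF q, of "(a - b - 1) div 2"]
  by (auto simp: step_kernel_def K1_def K2_def intro!: divide_nonneg_pos mult_nonneg_nonneg mult_pos_pos)

text \<open>The products over \<open>l\<close> agree on both sides, so each nonzero parity case is
  an identity between exponents of \<open>q\<close>. For \<open>b > a\<close> it would fail: the
  kernel is \<open>0\<close>, but the truncated \<open>a - b\<close> gives a nonzero weight.\<close>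

lemma kernel_gauge:
  assumes "b \<le> a"
  shows "step_kernel u q i a b * gauge_fn u q i a = gauge_fn u q (Suc i) b * col_weight u q i a b"
proof -
  obtain m where a: "a = b + m" using assms le_Suc_ex by blast
  have pos: "P'_O u q a > 0" "P'_Sp u q a > 0" by (rule P'_O_pos P'_Sp_pos)+
  let ?f = "((real a)\<^sup>2 - (real m)\<^sup>2) / 2"
  consider "odd i" "even m" | "odd i" "odd m" | "even i" "even m" | "even i" "odd m" by blast
  then show ?thesis
  proof cases
    case 1
    let ?x = "(real m)\<^sup>2 / 4" and ?e = "((real a)\<^sup>2 + real b) / 2 - real a"
      and ?g = "(real m)\<^sup>2 / 4 - real m"
      and ?P = "\<Prod>l = 1..m div 2. q ^ (2 * l) - 1"
    have "K2 u q a b * P'_O u q a = u ^ a * P'_Sp u q b * (q powr ?x / q powr ?e) / ?P"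
      using 1 pos by (simp add: K2_def a)
    also have "q powr ?x / q powr ?e = q powr (real b / 2) / (q powr ?f * q powr ?g)"
      unfolding powr_add[symmetric] powr_diff[symmetric]
      by (rule arg_cong[where f = "(powr) q"]) (simp add: a field_simps power2_eq_square)
    finally show ?thesis
      using 1 by (simp add: step_kernel_def gauge_fn_def col_weight_def mult_factor_def a mult_ac)
  next
    case 2
    let ?x = "((real m)\<^sup>2 - 1) / 4" and ?e = "((real a)\<^sup>2 - real a) / 2"
      and ?g = "(real m - 1)\<^sup>2 / 4"
      and ?P = "\<Prod>l = 1..(m - 1) div 2. q ^ (2 * l) - 1"
    have "K2 u q a b * P'_O u q a = u ^ a * P'_Sp u q b * (q powr ?x / q powr ?e) / ?P"
      using 2 pos by (simp add: K2_def a)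
    also have "q powr ?x / q powr ?e = q powr (real b / 2) / (q powr ?f * q powr ?g)"
      by (auto simp flip: powr_add powr_diff simp: a field_simps power2_eq_square)
    finally show ?thesis
      using 2 by (simp add: step_kernel_def gauge_fn_def col_weight_def mult_factor_def a mult_ac)
  next
    case 3
    let ?e = "((real a)\<^sup>2 - (real b)\<^sup>2 + 2 * (real a + 1) * real b) / 4"
      and ?g = "(real m)\<^sup>2 / 4 - real m / 2"
      and ?P = "\<Prod>l = 1..m div 2. q ^ (2 * l) - 1"
    have "K1 u q a b * (P'_Sp u q a * q powr (real a / 2))
        = u ^ a * P'_O u q b * (q powr (real a / 2) / q powr ?e) / ?P"
      using 3 pos by (simp add: K1_def a)
    also have "q powr (real a / 2) / q powr ?e = 1 / (q powr ?f * q powr ?g)"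
      using q by (simp flip: powr_add powr_diff powr_minus_divide)
        (simp add: a field_simps power2_eq_square)
    finally show ?thesis
      using 3 by (simp add: step_kernel_def gauge_fn_def col_weight_def mult_factor_def a mult_ac)
  next
    case 4
    then show ?thesis by (simp add: step_kernel_def col_weight_def K1_def a)
  qed
qed

end

section \<open>Factorisation of \<open>M_O\<close> over the columns\<close>

lemma c_O_eq: "c_O q lam i = mult_factor q i (count lam i)"
  by (simp add: c_O_def mult_factor_def Let_def)

definition norm_const :: "real \<Rightarrow> real \<Rightarrow> real" where
  "norm_const u q = 1 / (1 + u) * (\<Prod>r. 1 - u\<^sup>2 / q ^ (2 * r + 1))"

text \<open>Empty columns have weight \<open>1\<close>, so any cutoff from the sum of
  \<open>lam\<close> on will do; this permits comparison with arbitrarily long path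
  prefixes.\<close>

lemma M_O_eq:
  assumes q: "q > 1" and n: "sum_mset lam \<le> n" and lam: "lam \<in> partitions"
  shows "M_O u q lam = norm_const u q * (\<Prod>i = 1..n. col_weight u q i (col lam i) (col lam (Suc i)))"
proof -
  let ?W = "\<lambda>i. col_weight u q i (col lam i) (col lam (Suc i))"
  let ?s = "sum_mset lam"
  have count: "col lam i - col lam (Suc i) = count lam i" for i
    using col_Suc[of lam i] by simp
  have count0: "count lam i = 0" if "i \<notin> {1..?s}" for i
    using that lam col_eq_0[of lam i] col_Suc[of lam i]
    by (cases "i = 0") (auto simp: partitions_def count_eq_zero_iff)
  have "(\<Prod>i = 1..n. ?W i) = (\<Prod>i = 1..?s. ?W i)"
    using n q by (intro prod.mono_neutral_right) (auto simp: col_eq_0)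
  also have "norm_const u q * \<dots> = M_O u q lam"
  proof (cases "\<forall>i. i \<in># lam \<and> even i \<longrightarrow> even (count lam i)")
    case True
    have "?W i = u ^ col lam i / (q powr (((real (col lam i))\<^sup>2 - (real (count lam i))\<^sup>2) / 2) * c_O q lam i)" for i
      using True by (cases "i \<in># lam") (auto simp: col_weight_def count c_O_eq not_in_iff)
    then have *: "(\<Prod>i = 1..?s. ?W i) = u ^ (\<Sum>i = 1..?s. col lam i) /
      (q powr (\<Sum>i = 1..?s. ((real (col lam i))\<^sup>2 - (real (count lam i))\<^sup>2) / 2) * (\<Prod>i = 1..?s. c_O q lam i))"
      using q by (simp add: prod_dividef prod.distrib power_sum powr_sum)
    have **: "(\<Sum>i = 1..?s. ((real (col lam i))\<^sup>2 - (real (count lam i))\<^sup>2) / 2)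
      = ((\<Sum>i = 1..?s. (real (col lam i))\<^sup>2) - (\<Sum>i = 1..?s. (real (count lam i))\<^sup>2)) / 2"
      by (simp add: sum_subtractf flip: sum_divide_distrib)
    show ?thesis
      unfolding * ** using True by (simp add: M_O_def norm_const_def sum_col del: One_nat_def)
  next
    case False
    then obtain i where i: "i \<in># lam" "even i" "odd (count lam i)" by blast
    then have "i \<in> {1..?s}" using count0[of i] by (metis count_eq_zero_iff)
    moreover have "?W i = 0" using i by (simp add: col_weight_def count)
    ultimately have "(\<Prod>i = 1..?s. ?W i) = 0" by (intro prod_zero) auto
    then show ?thesis using False by (auto simp: M_O_def)
  qed
  finally show ?thesis by simp
qed

lemma M_O_nonneg:
  assumes "q > 1" "u \<ge> 0" "norm_const u q \<ge> 0" "lam \<in> partitions"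
  shows "M_O u q lam \<ge> 0"
  using assms by (simp add: M_O_eq[OF assms(1) order_refl] prod_nonneg col_weight_nonneg)

lemma P_O_eq: "P_O u q a = (\<integral>\<^sup>+lam. ennreal (M_O u q lam) \<partial>count_space {lam \<in> partitions. size lam = a})"
proof -
  let ?S = "{lam \<in> partitions. size lam = a}"
  have "P_O u q a = (\<integral>\<^sup>+lam. ennreal (M_O u q lam) * indicator ?S lam \<partial>count_space partitions)"
    unfolding P_O_def M_O_measure_def point_measure_def
    by (subst emeasure_density) (auto simp: Collect_conj_eq)
  also have "\<dots> = (\<integral>\<^sup>+lam. ennreal (M_O u q lam) \<partial>count_space ?S)"
    by (subst (1 2) nn_integral_count_space_indicator)
       (auto intro!: nn_integral_cong simp: indicator_def)
  finally show ?thesis .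
qed

section \<open>The column process and its prefix probabilities\<close>

lemma all_ge_1_iff: "(\<forall>j\<ge>(1::nat). P j) \<longleftrightarrow> (\<forall>n. \<forall>j\<in>{1..n}. P j)"
  by (metis atLeastAtMost_iff order_refl)

text \<open>Conditioning on the whole history builds in the Markov property. On a null history the
  conditional probability is \<open>0 / 0 = 0\<close> for every \<open>b\<close>, which is
  incompatible with a kernel row summing to one; hence the side condition in
  \<open>step\<close>.\<close>

locale column_process = prob_space N
  for N :: "'w measure" and X :: "nat \<Rightarrow> 'w \<Rightarrow> nat" and u q :: real +
  assumes q: "q > 1" and u: "0 < u" "u \<le> 1"
    and X: "\<And>i. i \<ge> 1 \<Longrightarrow> X i \<in> measurable N (count_space UNIV)"
    and initial: "\<And>a. emeasure N {\<omega> \<in> space N. X 1 \<omega> = a} = P_O u q a"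
    and step: "\<And>i h b. i \<ge> 1 \<Longrightarrow> \<P>(\<omega> in N. \<forall>j\<in>{1..i}. X j \<omega> = h j) \<noteq> 0 \<Longrightarrow>
        \<P>(\<omega> in N. X (i + 1) \<omega> = b \<bar> \<forall>j\<in>{1..i}. X j \<omega> = h j) = step_kernel u q i (h i) b"
begin

definition prefix_prob :: "(nat \<Rightarrow> nat) \<Rightarrow> nat \<Rightarrow> real" where
  "prefix_prob h n = \<P>(\<omega> in N. \<forall>j\<in>{1..n}. X j \<omega> = h j)"

lemma X_sets: "i \<ge> 1 \<Longrightarrow> {\<omega> \<in> space N. X i \<omega> = a} \<in> events"
  using measurable_sets[OF X, of i "{a}"] by (simp add: vimage_def Int_def conj_commute)

lemma prefix_sets: "{\<omega> \<in> space N. \<forall>j\<in>{1..n}. X j \<omega> = h j} \<in> events"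
  by (intro sets.sets_Collect_finite_All X_sets) auto

lemma path_sets: "{\<omega> \<in> space N. \<forall>j\<ge>1. X j \<omega> = h j} \<in> events"
proof -
  have "{\<omega> \<in> space N. \<forall>j\<ge>1. X j \<omega> = h j} = {\<omega> \<in> space N. \<forall>n. \<forall>j\<in>{1..n}. X j \<omega> = h j}"
    by (simp only: all_ge_1_iff)
  also have "\<dots> \<in> events"
    by (intro sets.sets_Collect_countable_All prefix_sets)
  finally show ?thesis .
qed

text \<open>The product rule persists past null histories: the longer prefix event lies inside the
  shorter one, so both sides are \<open>0\<close>.\<close>

lemma prefix_prob_Suc:
  assumes "n \<ge> 1"
  shows "prefix_prob h (Suc n) = prefix_prob h n * step_kernel u q n (h n) (h (Suc n))"
proof (cases "prefix_prob h n = 0")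
  case True
  have "prefix_prob h (Suc n) \<le> prefix_prob h n"
    unfolding prefix_prob_def by (intro finite_measure_mono prefix_sets) auto
  then show ?thesis
    using True by (simp add: prefix_prob_def measure_le_0_iff)
next
  case False
  have "{\<omega> \<in> space N. X (n + 1) \<omega> = h (n + 1) \<and> (\<forall>j\<in>{1..n}. X j \<omega> = h j)}
      = {\<omega> \<in> space N. \<forall>j\<in>{1..Suc n}. X j \<omega> = h j}"
    by (auto simp: le_Suc_eq)
  then show ?thesis
    using step[OF assms, of h "h (n + 1)"] False
    by (simp add: cond_prob_def prefix_prob_def field_simps)
qed

lemma prefix_prob_tendsto:
  "prefix_prob h \<longlonglongrightarrow> \<P>(\<omega> in N. \<forall>j\<ge>1. X j \<omega> = h j)"
proof -
  let ?A = "\<lambda>n. {\<omega> \<in> space N. \<forall>j\<in>{1..n}. X j \<omega> = h j}"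
  have "(\<lambda>n. prob (?A n)) \<longlonglongrightarrow> prob (\<Inter>n. ?A n)"
    by (intro finite_Lim_measure_decseq) (use prefix_sets in \<open>auto simp: decseq_def\<close>)
  also have "(\<Inter>n. ?A n) = {\<omega> \<in> space N. \<forall>j\<ge>1. X j \<omega> = h j}"
    unfolding all_ge_1_iff by auto
  finally show ?thesis unfolding prefix_prob_def .
qed

lemma prefix_prob_1: "prefix_prob h 1 = prob {\<omega> \<in> space N. X 1 \<omega> = h 1}"
  by (simp add: prefix_prob_def)

text \<open>By \<open>kernel_gauge\<close> each step trades the gauge factor at time
  \<open>i\<close> for the one at \<open>Suc i\<close>, so only the first and the last
  survive.\<close>

lemma prefix_prob_decreasing:
  assumes "\<And>i. 1 \<le> i \<Longrightarrow> i \<le> n \<Longrightarrow> h (Suc i) \<le> h i"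
  shows "prefix_prob h (Suc n) * gauge_fn u q 1 (h 1)
    = prob {\<omega> \<in> space N. X 1 \<omega> = h 1} * gauge_fn u q (Suc n) (h (Suc n))
      * (\<Prod>i = 1..n. col_weight u q i (h i) (h (Suc i)))"
  using assms
proof (induction n)
  case 0
  then show ?case using prefix_prob_1[of h] by simp
next
  case (Suc n)
  let ?n = "Suc n"
  have "prefix_prob h (Suc ?n) * gauge_fn u q 1 (h 1)
      = (prefix_prob h ?n * gauge_fn u q 1 (h 1)) * step_kernel u q ?n (h ?n) (h (Suc ?n))"
    by (simp add: prefix_prob_Suc)
  also have "prefix_prob h ?n * gauge_fn u q 1 (h 1)
    = prob {\<omega> \<in> space N. X 1 \<omega> = h 1} * gauge_fn u q ?n (h ?n)
      * (\<Prod>i = 1..n. col_weight u q i (h i) (h (Suc i)))"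
    using Suc by simp
  also have "\<dots> * step_kernel u q ?n (h ?n) (h (Suc ?n)) = prob {\<omega> \<in> space N. X 1 \<omega> = h 1} *
      (step_kernel u q ?n (h ?n) (h (Suc ?n)) * gauge_fn u q ?n (h ?n))
      * (\<Prod>i = 1..n. col_weight u q i (h i) (h (Suc i)))"
    by (simp only: mult_ac)
  also have "step_kernel u q ?n (h ?n) (h (Suc ?n)) * gauge_fn u q ?n (h ?n)
      = gauge_fn u q (Suc ?n) (h (Suc ?n)) * col_weight u q ?n (h ?n) (h (Suc ?n))"
    using Suc.prems by (intro kernel_gauge q u) auto
  finally show ?case by (simp add: mult_ac)
qed

section \<open>The sequence almost surely encodes a partition\<close>

lemma AE_decreasing: "AE \<omega> in N. \<forall>i\<ge>1. X (Suc i) \<omega> \<le> X i \<omega>"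
proof -
  have "AE \<omega> in N. X (Suc i) \<omega> \<le> X i \<omega>" if i: "i \<ge> 1" for i
  proof -
    \<comment> \<open>Histories are coded by lists, with entry \<open>0\<close> ignored, so that
      only countably many null events are united. The kernel vanishes on the last, increasing
      step.\<close>
    have "AE \<omega> in N. \<not> (\<forall>j\<in>{1..Suc i}. X j \<omega> = xs ! j)" if "xs ! i < xs ! Suc i" for xs :: "nat list"
    proof -
      have "prefix_prob ((!) xs) (Suc i) = 0"
        using that by (subst prefix_prob_Suc[OF i]) (simp add: step_kernel_def K1_def K2_def)
      then show ?thesis
        using prefix_sets[of "Suc i" "(!) xs"]
        by (intro AE_I[where N = "{\<omega> \<in> space N. \<forall>j\<in>{1..Suc i}. X j \<omega> = xs ! j}"])
           (auto simp: prefix_prob_def emeasure_eq_measure)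
    qed
    then have "AE \<omega> in N. \<forall>xs. xs ! i < xs ! Suc i \<longrightarrow> \<not> (\<forall>j\<in>{1..Suc i}. X j \<omega> = xs ! j)"
      unfolding AE_all_countable by auto
    then show ?thesis
    proof eventually_elim
      case (elim \<omega>)
      define xs where "xs = map (\<lambda>j. X j \<omega>) [0..<Suc (Suc i)]"
      have "xs ! j = X j \<omega>" if "j \<le> Suc i" for j
        using that unfolding xs_def by (subst nth_map) (auto simp del: upt_Suc)
      then have "\<not> X i \<omega> < X (Suc i) \<omega>" using elim[rule_format, of xs] by auto
      then show ?case by simp
    qed
  qed
  then show ?thesis by (simp add: AE_all_countable)
qed

text \<open>Each \<open>K2\<close> step followed by a \<open>K1\<close> step multiplies the prefix
  probability by at most \<open>1 / q\<close>, so it decays geometrically along the tail.\<close>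

lemma prob_const_tail:
  assumes a: "a \<ge> 1" and h: "\<And>j. j \<ge> m \<Longrightarrow> h j = a"
  shows "\<P>(\<omega> in N. \<forall>j\<ge>1. X j \<omega> = h j) = 0"
proof -
  \<comment> \<open>An odd time that is at least \<open>m\<close>: from here on all values are
    \<open>a\<close>, and each pair of steps starts with \<open>K2\<close>.\<close>
  let ?k = "2 * m + 1"
  have "prefix_prob h (?k + 2 * n) \<le> (1 / q) ^ n" for n
  proof (induction n)
    case 0
    show ?case by (simp add: prefix_prob_def)
  next
    case (Suc n)
    let ?l = "?k + 2 * n"
    have "prefix_prob h (?k + 2 * Suc n) = prefix_prob h ?l * K2 u q a a * K1 u q a a"
      using prefix_prob_Suc[of ?l h] prefix_prob_Suc[of "Suc ?l" h] by (simp add: h step_kernel_def)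
    also have "\<dots> \<le> (1 / q) ^ n * (1 / q) * 1"
      using Suc K2_diag_le[OF q u a] K1_diag_le[OF q u, of a] q
        kernel_nonneg[OF q u, of 1 a a] kernel_nonneg[OF q u, of 0 a a]
      by (intro mult_mono mult_nonneg_nonneg) (auto simp: step_kernel_def prefix_prob_def)
    finally show ?case by simp
  qed
  moreover have "(\<lambda>n. (1 / q) ^ n) \<longlonglongrightarrow> 0"
    using q by (intro LIMSEQ_power_zero) auto
  moreover have "(\<lambda>n. prefix_prob h (?k + 2 * n)) \<longlonglongrightarrow> \<P>(\<omega> in N. \<forall>j\<ge>1. X j \<omega> = h j)"
    using LIMSEQ_subseq_LIMSEQ[OF prefix_prob_tendsto, of "\<lambda>n. ?k + 2 * n" h]
    by (simp add: strict_mono_def o_def)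
  ultimately have "\<P>(\<omega> in N. \<forall>j\<ge>1. X j \<omega> = h j) \<le> 0"
    by (intro LIMSEQ_le) auto
  then show ?thesis by (simp add: measure_le_0_iff)
qed

text \<open>A decreasing sequence of naturals is eventually constant. The eventually constant
  sequences are countable, coded by a list and a limit, and each one with positive limit is null; so
  the limit is almost surely \<open>0\<close>.\<close>

lemma AE_partition: "AE \<omega> in N. \<exists>lam\<in>partitions. \<forall>i\<ge>1. X i \<omega> = col lam i"
proof -
  define ext :: "nat list \<Rightarrow> nat \<Rightarrow> nat \<Rightarrow> nat"
    where "ext xs c j = (if j < length xs then xs ! j else c)" for xs c j
  have "AE \<omega> in N. \<not> (\<forall>j\<ge>1. X j \<omega> = ext xs c j)" if "c \<ge> 1" for xs c
  proof -
    let ?A = "{\<omega> \<in> space N. \<forall>j\<ge>1. X j \<omega> = ext xs c j}"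
    have "prob ?A = 0"
      using that by (rule prob_const_tail[where m = "length xs"]) (simp add: ext_def)
    then have "?A \<in> null_sets N"
      by (intro null_setsI path_sets) (simp only: emeasure_eq_measure ennreal_0)
    then have "AE \<omega> in N. \<omega> \<notin> ?A" by (rule AE_not_in)
    then show ?thesis
      using AE_space by eventually_elim (simp only: mem_Collect_eq simp_thms)
  qed
  then have "AE \<omega> in N. \<forall>xs c. c \<ge> 1 \<longrightarrow> \<not> (\<forall>j\<ge>1. X j \<omega> = ext xs c j)"
    unfolding AE_all_countable by auto
  then show ?thesis
    using AE_decreasing
  proof eventually_elim
    case (elim \<omega>)
    \<comment> \<open>Once the least value is reached, monotonicity keeps the sequence
      there.\<close>
    define c where "c = (LEAST c. \<exists>n\<ge>1. X n \<omega> = c)"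
    have "\<exists>n\<ge>1. X n \<omega> = c"
      unfolding c_def by (rule LeastI_ex) auto
    then obtain n where n: "n \<ge> 1" "X n \<omega> = c" by blast
    have c: "X j \<omega> = c" if "j \<ge> n" for j
    proof (rule antisym)
      show "X j \<omega> \<le> c"
        using that
      proof (induction j rule: dec_induct)
        case base
        show ?case using n by simp
      next
        case (step j)
        then show ?case using elim(2) n(1) by (meson le_trans)
      qed
      show "c \<le> X j \<omega>"
        unfolding c_def using that n(1) by (intro Least_le) (auto intro: exI[of _ j])
    qed
    define xs where "xs = map (\<lambda>j. X j \<omega>) [0..<n]"
    have "ext xs c j = X j \<omega>" for j
      using c by (simp add: ext_def xs_def)
    then have "c = 0" using elim(1) by (metis One_nat_def Suc_leI gr0I)
    then show ?case
      using ex_partition_col[of "\<lambda>i. X i \<omega>" n] elim(2) c by blast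
  qed
qed

section \<open>Path probabilities and their normalisation\<close>

lemma path_prob_eq:
  assumes lam: "lam \<in> partitions" and C: "norm_const u q \<noteq> 0"
  shows "\<P>(\<omega> in N. \<forall>i\<ge>1. X i \<omega> = col lam i)
    = prob {\<omega> \<in> space N. X 1 \<omega> = size lam} / (norm_const u q * P'_O u q (size lam)) * M_O u q lam"
    (is "_ = ?r")
proof -
  let ?s = "sum_mset lam"
  have pos: "P'_O u q (size lam) > 0" by (rule P'_O_pos[OF q u])
  \<comment> \<open>Column \<open>Suc n\<close> is empty for such \<open>n\<close>, so the last
    gauge factor is \<open>1\<close> and the prefix probability has become stationary.\<close>
  have "prefix_prob (col lam) (Suc n) = ?r" if n: "n \<ge> ?s" for n
  proof -
    have "prefix_prob (col lam) (Suc n) * gauge_fn u q 1 (col lam 1)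
      = prob {\<omega> \<in> space N. X 1 \<omega> = col lam 1} * gauge_fn u q (Suc n) (col lam (Suc n))
        * (\<Prod>i = 1..n. col_weight u q i (col lam i) (col lam (Suc i)))"
      by (rule prefix_prob_decreasing) (metis col_Suc le_add2)
    moreover have "col lam (Suc n) = 0" using n by (simp add: col_eq_0)
    moreover have "col lam 1 = size lam" by (rule col_1[OF lam])
    moreover have "gauge_fn u q 1 (size lam) = P'_O u q (size lam)" by (simp add: gauge_fn_def)
    ultimately show ?thesis
      using pos C q M_O_eq[OF q n lam, of u] by (simp add: field_simps)
  qed
  then have "eventually (\<lambda>n. prefix_prob (col lam) n = ?r) sequentially"
    unfolding eventually_sequentially by (intro exI[of _ "Suc ?s"]) (metis Suc_le_D Suc_le_mono)
  then have "prefix_prob (col lam) \<longlonglongrightarrow> ?r" by (rule tendsto_eventually)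
  then show ?thesis using prefix_prob_tendsto LIMSEQ_unique by blast
qed

text \<open>Path events of distinct partitions are disjoint because the columns determine the
  partition; by \<open>AE_partition\<close> they exhaust the event on \<open>X 1\<close> up to a
  null set.\<close>

lemma size_prob_sum:
  "emeasure N {\<omega> \<in> space N. X 1 \<omega> = a}
    = (\<integral>\<^sup>+lam. emeasure N {\<omega> \<in> space N. \<forall>i\<ge>1. X i \<omega> = col lam i}
        \<partial>count_space {lam \<in> partitions. size lam = a})"
proof -
  let ?S = "{lam \<in> partitions. size lam = a}"
  let ?E = "\<lambda>lam. {\<omega> \<in> space N. \<forall>i\<ge>1. X i \<omega> = col lam i}"
  have "disjoint_family_on ?E ?S"
    unfolding disjoint_family_on_def
  proof (intro ballI impI)
    fix lam mu assume "lam \<in> ?S" "mu \<in> ?S" "lam \<noteq> mu"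
    then have "\<exists>i\<ge>1. col lam i \<noteq> col mu i" using col_inject[of lam mu] by auto
    then show "?E lam \<inter> ?E mu = {}" by force
  qed
  then have "emeasure N (\<Union>lam\<in>?S. ?E lam) = (\<integral>\<^sup>+lam. emeasure N (?E lam) \<partial>count_space ?S)"
    by (rule emeasure_UN_countable[OF path_sets countable_multisets])
  moreover have "emeasure N {\<omega> \<in> space N. X 1 \<omega> = a} = emeasure N (\<Union>lam\<in>?S. ?E lam)"
  proof (rule emeasure_eq_AE)
    show "AE \<omega> in N. \<omega> \<in> {\<omega> \<in> space N. X 1 \<omega> = a} \<longleftrightarrow> \<omega> \<in> (\<Union>lam\<in>?S. ?E lam)"
      using AE_partition
    proof eventually_elim
      case (elim \<omega>)
      then obtain lam where lam: "lam \<in> partitions" "\<forall>i\<ge>1. X i \<omega> = col lam i" by blast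
      then have "X 1 \<omega> = size lam" using col_1[of lam] by simp
      show ?case
      proof
        assume "\<omega> \<in> {\<omega> \<in> space N. X 1 \<omega> = a}"
        then show "\<omega> \<in> (\<Union>lam\<in>?S. ?E lam)"
          using lam \<open>X 1 \<omega> = size lam\<close> by (intro UN_I[of lam]) auto
      next
        assume "\<omega> \<in> (\<Union>lam\<in>?S. ?E lam)"
        then obtain mu where mu: "mu \<in> ?S" "\<omega> \<in> ?E mu" by (rule UN_E)
        then show "\<omega> \<in> {\<omega> \<in> space N. X 1 \<omega> = a}"
          using col_1[of mu] by simp
      qed
    qed
  next
    show "(\<Union>lam\<in>?S. ?E lam) \<in> events"
      by (intro sets.countable_UN'' path_sets countable_multisets)
  qed (simp add: X_sets)
  ultimately show ?thesis by simp
qed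

text \<open>Otherwise \<open>ennreal\<close> truncates every value of \<open>M_O\<close> to
  \<open>0\<close>, every \<open>P_O u q a\<close> vanishes, and \<open>X 1\<close> almost surely
  takes no value at all.\<close>

lemma norm_const_pos: "norm_const u q > 0"
proof (rule ccontr)
  assume "\<not> norm_const u q > 0"
  then have "M_O u q lam \<le> 0" if "lam \<in> partitions" for lam
    using that q u
    by (subst M_O_eq[OF q order_refl]) (auto intro!: mult_nonpos_nonneg prod_nonneg col_weight_nonneg)
  then have "P_O u q a = 0" for a
    unfolding P_O_eq by (subst nn_integral_0_iff_AE) (auto simp: AE_count_space ennreal_neg)
  then have "AE \<omega> in N. X 1 \<omega> \<noteq> a" for a
    using initial[of a] X_sets[of 1 a] by (intro AE_I[where N = "{\<omega> \<in> space N. X 1 \<omega> = a}"]) auto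
  then have "AE \<omega> in N. \<forall>a. X 1 \<omega> \<noteq> a"
    unfolding AE_all_countable by blast
  then have "AE \<omega> in N. False" by simp
  then show False by simp
qed

lemma path_prob:
  assumes lam: "lam \<in> partitions"
  shows "\<P>(\<omega> in N. \<forall>i\<ge>1. X i \<omega> = col lam i) = M_O u q lam"
proof -
  define a where "a = size lam"
  let ?S = "{lam \<in> partitions. size lam = a}"
  let ?E = "\<lambda>lam. {\<omega> \<in> space N. \<forall>i\<ge>1. X i \<omega> = col lam i}"
  define p where "p = prob {\<omega> \<in> space N. X 1 \<omega> = a}"
  define r where "r = p / (norm_const u q * P'_O u q a)"
  note C = norm_const_pos
  have M: "M_O u q mu \<ge> 0" if "mu \<in> partitions" for mu
    using that C q u by (intro M_O_nonneg) auto
  have r: "r \<ge> 0" using C P'_O_pos[OF q u, of a] by (simp add: r_def p_def)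
  have E: "prob (?E mu) = r * M_O u q mu" if "mu \<in> ?S" for mu
    using path_prob_eq[of mu] that C by (simp add: r_def p_def)
  have P: "P_O u q a = ennreal p"
    using initial[of a] by (simp add: p_def emeasure_eq_measure)
  have E_emeasure: "emeasure N (?E mu) = ennreal r * ennreal (M_O u q mu)" if "mu \<in> ?S" for mu
    unfolding emeasure_eq_measure E[OF that] using that r M by (simp add: ennreal_mult)
  have "ennreal p = (\<integral>\<^sup>+mu. emeasure N (?E mu) \<partial>count_space ?S)"
    using size_prob_sum[of a] initial[of a] P by simp
  also have "\<dots> = (\<integral>\<^sup>+mu. ennreal r * ennreal (M_O u q mu) \<partial>count_space ?S)"
    by (intro nn_integral_cong) (simp only: space_count_space E_emeasure)
  also have "\<dots> = ennreal r * P_O u q a"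
    by (simp add: nn_integral_cmult P_O_eq)
  finally have "ennreal p = ennreal (r * p)"
    using P r by (simp add: ennreal_mult p_def)
  then have rp: "p = r * p" using r by (simp add: p_def)
  show ?thesis
  proof (cases "p = 0")
    case True
    \<comment> \<open>Here \<open>r = 0\<close> and \<open>p = r * p\<close> says nothing; instead a
      vanishing sum of nonnegative terms makes \<open>M_O\<close> zero on all partitions with
      \<open>a\<close> parts.\<close>
    have "AE mu in count_space ?S. ennreal (M_O u q mu) = 0"
      using P True unfolding P_O_eq by (subst nn_integral_0_iff_AE[symmetric]) auto
    then have "M_O u q lam = 0"
      using lam M[OF lam] by (auto simp: AE_count_space a_def)
    then show ?thesis using E[of lam] lam by (simp add: a_def)
  next
    case False
    then show ?thesis using rp E[of lam] lam by (simp add: a_def)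
  qed
qed

end

theorem theorem5:
  fixes q :: nat and u :: real
    and N :: "'w measure" and X :: "nat \<Rightarrow> 'w \<Rightarrow> nat"
  assumes q: "primepow q" "odd q"
    and u: "0 < u" "u \<le> 1"
    and N: "prob_space N"
    and X: "\<And>i. i \<ge> 1 \<Longrightarrow> X i \<in> measurable N (count_space UNIV)"
    and initial: "\<And>a. emeasure N {\<omega> \<in> space N. X 1 \<omega> = a} = P_O u (real q) a"
    and step: "\<And>i h b. i \<ge> 1 \<Longrightarrow> \<P>(\<omega> in N. \<forall>j\<in>{1..i}. X j \<omega> = h j) \<noteq> 0 \<Longrightarrow>
        \<P>(\<omega> in N. X (i + 1) \<omega> = b \<bar> \<forall>j\<in>{1..i}. X j \<omega> = h j)
          = (if odd i then K2 u (real q) (h i) b else K1 u (real q) (h i) b)"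
  shows "(AE \<omega> in N. \<exists>lam\<in>partitions. \<forall>i\<ge>1. X i \<omega> = col lam i) \<and>
    (\<forall>lam\<in>partitions. \<P>(\<omega> in N. \<forall>i\<ge>1. X i \<omega> = col lam i) = M_O u (real q) lam)"
proof -
  have "real q > 1" using primepow_gt_Suc_0[OF q(1)] by simp
  then interpret column_process N X u "real q"
    using u X initial step N
    by (intro column_process.intro column_process_axioms.intro) (auto simp: step_kernel_def)
  show ?thesis using AE_partition path_prob by blast
qed

end
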